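(* Let $z_n\to z$ in $Y$ and assume that $S\colon U\to Y$ satisfies the following: (1) $u_i\rightharpoonup u$ in $U$ implies $S(u_i)\rightharpoonup S(u)$ in $Y$; (2) $S$ is Fréchet differentiable; (3) $S$ is compact; (4) there is a Banach space $V$ with $U\hookrightarrow V$ and $V^*\hookrightarrow L^\infty(\Omega;\mathbb R^m)$ such that $S'(u)^*$ maps $Y$ into $V^*$ for every $u\in U$ and, for every $u\in U$ and $y\in Y$, $\|[S'(\tilde u)-S'(u)]^*y\|_{V^*}\to0$ as $\tilde u\rightharpoonup u$ in $U$. Let $u_n$ be minimizers of $\mathcal E^{z_n}$ over $U$, with dual variables $p_n=S'(u_n)^*(z_n-S(u_n))$, such that (after passing to a subsequence, not relabeled) $u_n\rightharpoonup\bar u$ in $U$, $S(u_n)\to S(\bar u)$ in $Y$, and $p_n\to\bar p$ in $V^*$, where $\bar u$ is a minimizer of $\mathcal E^z$, $-\bar p=S'(\bar u)^*(S(\bar u)-z)$, and $\bar u\in\partial\mathcal G^*(\bar p)$. Let $Q\subset\mathbb R^m$ be the set on which $\partial g^*$ is single-valued, and for $P\subset\mathbb R^m$ set $\Omega_P=\{x\in\Omega:\bar p(x)\in P\}$. Then: (i) for any compact $P\subset Q$ and all $n$ large enough, $u_n(x)=\bar u(x)\in\mathcal M$ for a.e. $x\in\Omega_P$; (ii) $u_n|_{\Omega_Q}\to\bar u|_{\Omega_Q}$ strongly in $L^2(\Omega_Q;\mathbb R^m)$, and $\bar u(x)\in\mathcal M$ for a.e. $x\in\Omega_Q$.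
   Context: $\Omega\subset\mathbb R^n$ is a bounded open domain, $m\ge 2$, $U=L^2(\Omega;\mathbb R^m)$ (identified with its dual), $Y$ is a (real) Hilbert space, and $S\colon U\to Y$ is a (possibly nonlinear) operator. $\mathcal M\subset\mathbb R^m$ is a (nonempty) finite set, $\alpha>0$, $c\colon\mathbb R^m\to\mathbb R$ is non-negative, strictly convex, and lower semi-continuous, and $g=(\alpha c+\delta_{\mathcal M})^{**}$ (biconjugate, i.e. convex envelope), where $\delta_{\mathcal M}$ is $0$ on $\mathcal M$ and $\infty$ elsewhere; thus $\operatorname{dom} g=\operatorname{co}\mathcal M$. $g^*$ is the Legendre--Fenchel conjugate of $g$ and $\partial g^*$ its convex subdifferential. For $z\in Y$, $\mathcal E^z(u)=\frac12\|S(u)-z\|_Y^2+\mathcal G(u)$ with $\mathcal G(u)=\int_\Omega g(u(x))\,\mathrm dx$, $u\in U$. $\mathcal G^*$ is the Legendre--Fenchel conjugate of $\mathcal G$ on $U$; its subdifferential is $\partial\mathcal G^*(p)=\{u\in U: u(x)\in\partial g^*(p(x))\text{ for a.e. }x\in\Omega\}$. $S'(u)^*\colon Y\to U$ is the Hilbert-space adjoint of the Fréchet derivative $S'(u)$. $\hookrightarrow$ denotes continuous embedding; $V^*$ is regarded as a subspace of $L^\infty(\Omega;\mathbb R^m)\subset U$ compatibly with the embedding $U\hookrightarrow V$, i.e., the pairing of $v^*\in V^*$ with $u\in U\hookrightarrow V$ is $\int_\Omega v^*\cdot u\,\mathrm dx$. Compactness of $S$ means that bounded sets are mapped to relatively compact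 sets; limits under weak convergence are understood for sequences. *)

theory Defs
  imports "HOL-Analysis.Analysis"
begin

section \<open>The space \<open>L\<^sup>2(\<Omega>; \<real>\<^sup>m)\<close>\<close>

text \<open>
  Elements of \<open>L\<^sup>2\<close> are represented by square-integrable functions; equality in \<open>L\<^sup>2\<close> is
  equality almost everywhere on \<open>\<Omega>\<close>. A map out of \<open>L\<^sup>2\<close> is a map on functions whose values
  on \<open>L2 \<Omega>\<close> depend only on the a.e.-class; its values outside \<open>L2 \<Omega>\<close> are irrelevant.
\<close>

definition L2 :: "(real^'n) set \<Rightarrow> (real^'n \<Rightarrow> real^'m) set" where
  "L2 \<Omega> = {u. u \<in> borel_measurable (lebesgue_on \<Omega>) \<and>
              integrable (lebesgue_on \<Omega>) (\<lambda>x. (norm (u x))\<^sup>2)}"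

definition L2_eq :: "(real^'n) set \<Rightarrow> (real^'n \<Rightarrow> real^'m) \<Rightarrow> (real^'n \<Rightarrow> real^'m) \<Rightarrow> bool" where
  "L2_eq \<Omega> u v \<longleftrightarrow> (AE x in lebesgue_on \<Omega>. u x = v x)"

definition L2_inner :: "(real^'n) set \<Rightarrow> (real^'n \<Rightarrow> real^'m) \<Rightarrow> (real^'n \<Rightarrow> real^'m) \<Rightarrow> real" where
  "L2_inner \<Omega> u v = (LINT x|lebesgue_on \<Omega>. u x \<bullet> v x)"

definition L2_norm :: "(real^'n) set \<Rightarrow> (real^'n \<Rightarrow> real^'m) \<Rightarrow> real" where
  "L2_norm \<Omega> u = sqrt (L2_inner \<Omega> u u)"

definition L2_weakly_tendsto ::
    "(real^'n) set \<Rightarrow> (nat \<Rightarrow> real^'n \<Rightarrow> real^'m) \<Rightarrow> (real^'n \<Rightarrow> real^'m) \<Rightarrow> bool" where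
  "L2_weakly_tendsto \<Omega> u v \<longleftrightarrow> (\<forall>i. u i \<in> L2 \<Omega>) \<and> v \<in> L2 \<Omega> \<and>
     (\<forall>w\<in>L2 \<Omega>. (\<lambda>i. L2_inner \<Omega> (u i) w) \<longlonglongrightarrow> L2_inner \<Omega> v w)"

definition weakly_tendsto :: "(nat \<Rightarrow> 'y::real_inner) \<Rightarrow> 'y \<Rightarrow> bool" where
  "weakly_tendsto y z \<longleftrightarrow> (\<forall>w. (\<lambda>i. y i \<bullet> w) \<longlonglongrightarrow> z \<bullet> w)"

definition L2_well_defined ::
    "(real^'n) set \<Rightarrow> ((real^'n \<Rightarrow> real^'m) \<Rightarrow> 'a) \<Rightarrow> bool" where
  "L2_well_defined \<Omega> F \<longleftrightarrow> (\<forall>u\<in>L2 \<Omega>. \<forall>v\<in>L2 \<Omega>. L2_eq \<Omega> u v \<longrightarrow> F u = F v)"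

text \<open>The boundedness clause also makes the map well defined on a.e.-classes.\<close>

definition L2_bounded_linear ::
    "(real^'n) set \<Rightarrow> ((real^'n \<Rightarrow> real^'m) \<Rightarrow> 'a::real_normed_vector) \<Rightarrow> bool" where
  "L2_bounded_linear \<Omega> D \<longleftrightarrow>
     (\<forall>h\<in>L2 \<Omega>. \<forall>k\<in>L2 \<Omega>. D (\<lambda>x. h x + k x) = D h + D k) \<and>
     (\<forall>h\<in>L2 \<Omega>. \<forall>r. D (\<lambda>x. r *\<^sub>R h x) = r *\<^sub>R D h) \<and>
     (\<exists>C. \<forall>h\<in>L2 \<Omega>. norm (D h) \<le> C * L2_norm \<Omega> h)"

definition L2_has_derivative ::
    "(real^'n) set \<Rightarrow> ((real^'n \<Rightarrow> real^'m) \<Rightarrow> 'a::real_normed_vector) \<Rightarrow>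
     ((real^'n \<Rightarrow> real^'m) \<Rightarrow> 'a) \<Rightarrow> (real^'n \<Rightarrow> real^'m) \<Rightarrow> bool" where
  "L2_has_derivative \<Omega> S D u \<longleftrightarrow> L2_bounded_linear \<Omega> D \<and>
     (\<forall>e>0. \<exists>d>0. \<forall>h\<in>L2 \<Omega>. L2_norm \<Omega> h < d \<longrightarrow>
        norm (S (\<lambda>x. u x + h x) - S u - D h) \<le> e * L2_norm \<Omega> h)"

definition L2_is_adjoint ::
    "(real^'n) set \<Rightarrow> ((real^'n \<Rightarrow> real^'m) \<Rightarrow> 'y::real_inner) \<Rightarrow>
     ('y \<Rightarrow> real^'n \<Rightarrow> real^'m) \<Rightarrow> bool" where
  "L2_is_adjoint \<Omega> D A \<longleftrightarrow>
     (\<forall>y. A y \<in> L2 \<Omega> \<and> (\<forall>h\<in>L2 \<Omega>. D h \<bullet> y = L2_inner \<Omega> h (A y)))"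

definition L2_compact_operator ::
    "(real^'n) set \<Rightarrow> ((real^'n \<Rightarrow> real^'m) \<Rightarrow> 'a::real_normed_vector) \<Rightarrow> bool" where
  "L2_compact_operator \<Omega> S \<longleftrightarrow>
     (\<forall>B. B \<subseteq> L2 \<Omega> \<and> (\<exists>r. \<forall>u\<in>B. L2_norm \<Omega> u \<le> r) \<longrightarrow> compact (closure (S ` B)))"


section \<open>The embeddings \<open>U \<hookrightarrow> V\<close> and \<open>V\<^sup>* \<hookrightarrow> L\<^sup>\<infinity>\<close>\<close>

definition L2_embedding ::
    "(real^'n) set \<Rightarrow> ((real^'n \<Rightarrow> real^'m) \<Rightarrow> 'v::real_normed_vector) \<Rightarrow> bool" where
  "L2_embedding \<Omega> \<iota> \<longleftrightarrow> L2_bounded_linear \<Omega> \<iota> \<and>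
     (\<forall>u\<in>L2 \<Omega>. \<iota> u = 0 \<longrightarrow> L2_eq \<Omega> u (\<lambda>x. 0))"

text \<open>
  \<open>j w\<close> is a representative of the \<open>L\<^sup>\<infinity>\<close>-class of the functional \<open>w\<close>; hence linearity and
  injectivity are only up to null sets. The last clause is the compatibility of the pairing
  of \<open>V\<^sup>*\<close> and \<open>V\<close> with the \<open>L\<^sup>2\<close>-pairing.
\<close>

definition dual_Linf_embedding ::
    "(real^'n) set \<Rightarrow> ((real^'n \<Rightarrow> real^'m) \<Rightarrow> 'v::real_normed_vector) \<Rightarrow>
     (('v \<Rightarrow>\<^sub>L real) \<Rightarrow> real^'n \<Rightarrow> real^'m) \<Rightarrow> bool" where
  "dual_Linf_embedding \<Omega> \<iota> j \<longleftrightarrow>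
     (\<forall>w. j w \<in> borel_measurable (lebesgue_on \<Omega>)) \<and>
     (\<exists>C. \<forall>w. AE x in lebesgue_on \<Omega>. norm (j w x) \<le> C * norm w) \<and>
     (\<forall>w w'. L2_eq \<Omega> (j (w + w')) (\<lambda>x. j w x + j w' x)) \<and>
     (\<forall>r w. L2_eq \<Omega> (j (r *\<^sub>R w)) (\<lambda>x. r *\<^sub>R j w x)) \<and>
     (\<forall>w. L2_eq \<Omega> (j w) (\<lambda>x. 0) \<longrightarrow> w = 0) \<and>
     (\<forall>w. \<forall>u\<in>L2 \<Omega>. blinfun_apply w (\<iota> u) = L2_inner \<Omega> (j w) u)"


section \<open>Convex analysis\<close>

text \<open>
  Legendre--Fenchel conjugate and convex subdifferential with respect to a carrier \<open>X\<close> and a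
  pairing \<open>B\<close>. They are used for \<open>\<real>\<^sup>m\<close> with its inner product and for \<open>L2 \<Omega>\<close> with the
  \<open>L\<^sup>2\<close>-inner product (both identified with their dual).
\<close>

definition conjugate_on ::
    "'a set \<Rightarrow> ('a \<Rightarrow> 'a \<Rightarrow> real) \<Rightarrow> ('a \<Rightarrow> ereal) \<Rightarrow> 'a \<Rightarrow> ereal" where
  "conjugate_on X B F p = (SUP x\<in>X. ereal (B p x) - F x)"

definition subdiff_on ::
    "'a::minus set \<Rightarrow> ('a \<Rightarrow> 'a \<Rightarrow> real) \<Rightarrow> ('a \<Rightarrow> ereal) \<Rightarrow> 'a \<Rightarrow> 'a set" where
  "subdiff_on X B F p =
     {u\<in>X. \<bar>F p\<bar> \<noteq> \<infinity> \<and> (\<forall>q\<in>X. F p + ereal (B u (q - p)) \<le> F q)}"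

abbreviation conjugate :: "('a::real_inner \<Rightarrow> ereal) \<Rightarrow> 'a \<Rightarrow> ereal" where
  "conjugate \<equiv> conjugate_on UNIV inner"

abbreviation subdiff :: "('a::real_inner \<Rightarrow> ereal) \<Rightarrow> 'a \<Rightarrow> 'a set" where
  "subdiff \<equiv> subdiff_on UNIV inner"

definition strictly_convex :: "('a::real_vector \<Rightarrow> real) \<Rightarrow> bool" where
  "strictly_convex f \<longleftrightarrow>
     (\<forall>x y t. x \<noteq> y \<and> 0 < t \<and> t < 1 \<longrightarrow>
        f ((1 - t) *\<^sub>R x + t *\<^sub>R y) < (1 - t) * f x + t * f y)"

definition lower_semicontinuous :: "('a::topological_space \<Rightarrow> real) \<Rightarrow> bool" where
  "lower_semicontinuous f \<longleftrightarrow> (\<forall>x. \<forall>a<f x. \<forall>\<^sub>F y in nhds x. a < f y)"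


section \<open>The multibang penalty and the functionals\<close>

definition indicator_fun :: "'a set \<Rightarrow> 'a \<Rightarrow> ereal" where
  "indicator_fun M v = (if v \<in> M then 0 else \<infinity>)"

definition penalty :: "real \<Rightarrow> ('a::real_inner \<Rightarrow> real) \<Rightarrow> 'a set \<Rightarrow> 'a \<Rightarrow> ereal" where
  "penalty \<alpha> c M = conjugate (conjugate (\<lambda>v. ereal (\<alpha> * c v) + indicator_fun M v))"

text \<open>
  The penalty is non-negative, so its integral is a well-defined element of \<open>[0, \<infinity>]\<close> and the
  truncation in \<open>e2ennreal\<close> is harmless.
\<close>

lemma penalty_nonneg:
  assumes "\<alpha> > 0" and "\<And>v. c v \<ge> 0"
  shows "penalty \<alpha> c M v \<ge> 0"
proof -
  define F where "F = (\<lambda>v. ereal (\<alpha> * c v) + indicator_fun M v)"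
  have "F x \<ge> 0" for x
    using assms by (simp add: F_def indicator_fun_def)
  then have "conjugate F 0 \<le> 0"
    unfolding conjugate_on_def by (intro SUP_least) (simp add: ereal_minus_le_iff zero_ereal_def[symmetric])
  then have "0 \<le> ereal (v \<bullet> 0) - conjugate F 0"
    by (simp add: zero_ereal_def[symmetric] ereal_uminus_le_reorder)
  also have "\<dots> \<le> conjugate (conjugate F) v"
    unfolding conjugate_on_def[of _ _ "conjugate F"] by (rule SUP_upper) simp
  finally show ?thesis
    by (simp add: penalty_def F_def)
qed

definition integral_functional ::
    "(real^'n) set \<Rightarrow> (real^'m \<Rightarrow> ereal) \<Rightarrow> (real^'n \<Rightarrow> real^'m) \<Rightarrow> ereal" where
  "integral_functional \<Omega> g u = enn2ereal (\<integral>\<^sup>+x. e2ennreal (g (u x)) \<partial>lebesgue_on \<Omega>)"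

definition energy ::
    "(real^'n) set \<Rightarrow> (real^'m \<Rightarrow> ereal) \<Rightarrow> ((real^'n \<Rightarrow> real^'m) \<Rightarrow> 'y::real_normed_vector) \<Rightarrow>
     'y \<Rightarrow> (real^'n \<Rightarrow> real^'m) \<Rightarrow> ereal" where
  "energy \<Omega> g S z u = ereal (1/2 * (norm (S u - z))\<^sup>2) + integral_functional \<Omega> g u"

definition single_valued_set :: "(real^'m \<Rightarrow> ereal) \<Rightarrow> (real^'m) set" where
  "single_valued_set g = {q. \<exists>v. subdiff (conjugate g) q = {v}}"

definition Omega_part :: "(real^'n) set \<Rightarrow> (real^'n \<Rightarrow> real^'m) \<Rightarrow> (real^'m) set \<Rightarrow> (real^'n) set" where
  "Omega_part \<Omega> p P = {x\<in>\<Omega>. p x \<in> P}"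

end

theory Submission
  imports Defs
begin

text \<open>
  The conjugate \<open>g\<^sup>*\<close> of the multibang penalty is the maximum of the affine functions
  \<open>q \<mapsto> q \<bullet> v - \<alpha> c v\<close> with \<open>v \<in> M\<close>. Its subdifferential at \<open>q\<close> contains every \<open>v\<close> that
  attains the maximum, so it is single-valued exactly where one \<open>v\<close> strictly dominates all
  others (\<open>single_valued_set_eq\<close>). The region where a given \<open>v\<close> dominates is open, and on it
  the only subgradient is \<open>v\<close> (\<open>subgradient_dominance\<close>). The subdifferential is thus locally
  constant on \<open>Q\<close>, with values in \<open>M\<close>.

  A minimizer \<open>u\<close> of the energy with dual variable \<open>q\<close> satisfies \<open>u x \<in> \<partial>g\<^sup>* (q x)\<close> for almost
  every \<open>x\<close> (\<open>minimizer_subgradient\<close>), because \<open>u\<close> can be perturbed on any measurable set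
  towards any element of \<open>M\<close>. This applies to each \<open>u n\<close> with \<open>p n\<close> and to \<open>ubar\<close> with
  \<open>pbar\<close>.

  Convergence in the dual of \<open>V\<close> makes \<open>p n\<close> converge to \<open>pbar\<close> uniformly almost everywhere.
  Over a compact \<open>P \<subseteq> Q\<close>, a Lebesgue number for the cover by the dominance regions puts
  \<open>p n x\<close> and \<open>pbar x\<close> into the same region for all large \<open>n\<close>, uniformly in \<open>x\<close>; then \<open>u n x\<close>
  and \<open>ubar x\<close> equal the same element of \<open>M\<close>. Over all of \<open>Q\<close> the same argument works at each
  point separately, and since all subgradients are bounded by the largest norm in \<open>M\<close>
  (\<open>subgradient_norm_le\<close>), dominated convergence on the bounded domain gives strong convergence.
\<close>

section \<open>The penalty of a finite set and its conjugate\<close>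

text \<open>
  The conjugate of the function that is \<open>b\<close> on \<open>M\<close> and \<open>\<infinity>\<close> elsewhere: a maximum of finitely
  many affine functions, one for each admissible value.
\<close>

definition finite_conj :: "('a::real_inner \<Rightarrow> real) \<Rightarrow> 'a set \<Rightarrow> 'a \<Rightarrow> real" where
  "finite_conj b M q = Max ((\<lambda>v. q \<bullet> v - b v) ` M)"

lemma finite_conj_ge: "finite M \<Longrightarrow> v \<in> M \<Longrightarrow> q \<bullet> v - b v \<le> finite_conj b M q"
  by (auto simp: finite_conj_def)

lemma finite_conj_attained:
  assumes "finite M" "M \<noteq> {}"
  obtains v where "v \<in> M" "finite_conj b M q = q \<bullet> v - b v"
proof -
  have "finite_conj b M q \<in> (\<lambda>v. q \<bullet> v - b v) ` M"
    unfolding finite_conj_def using assms by (intro Max_in) auto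
  then show ?thesis using that by auto
qed

lemma conjugate_finite_conj:
  assumes "finite M" "M \<noteq> {}"
  shows "conjugate (\<lambda>v. ereal (b v) + indicator_fun M v) q = ereal (finite_conj b M q)"
proof (rule antisym)
  show "conjugate (\<lambda>v. ereal (b v) + indicator_fun M v) q \<le> ereal (finite_conj b M q)"
    unfolding conjugate_on_def
    by (intro SUP_least) (auto simp: indicator_fun_def finite_conj_ge[OF assms(1)])
next
  obtain v where v: "v \<in> M" "finite_conj b M q = q \<bullet> v - b v"
    using finite_conj_attained[OF assms] .
  show "ereal (finite_conj b M q) \<le> conjugate (\<lambda>v. ereal (b v) + indicator_fun M v) q"
    unfolding conjugate_on_def
    by (rule SUP_upper2[of v]) (auto simp: v indicator_fun_def)
qed

lemma penalty_eq_SUP: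
  assumes "finite M" "M \<noteq> {}"
  shows "penalty \<alpha> c M x = (SUP q. ereal (x \<bullet> q - finite_conj (\<lambda>v. \<alpha> * c v) M q))"
proof -
  have "conjugate (\<lambda>v. ereal (\<alpha> * c v) + indicator_fun M v)
      = (\<lambda>q. ereal (finite_conj (\<lambda>v. \<alpha> * c v) M q))"
    by (rule ext) (rule conjugate_finite_conj[OF assms])
  then show ?thesis
    by (simp add: penalty_def conjugate_on_def[of _ _ "\<lambda>q. ereal (finite_conj _ M q)"])
qed

lemma penalty_Fenchel_Young:
  assumes "finite M" "M \<noteq> {}"
  shows "ereal (x \<bullet> q - finite_conj (\<lambda>v. \<alpha> * c v) M q) \<le> penalty \<alpha> c M x"
  unfolding penalty_eq_SUP[OF assms] by (rule SUP_upper) simp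

lemma penalty_le_on_M:
  assumes "finite M" "v \<in> M"
  shows "penalty \<alpha> c M v \<le> ereal (\<alpha> * c v)"
proof -
  have M: "M \<noteq> {}" using assms by auto
  show ?thesis
    unfolding penalty_eq_SUP[OF assms(1) M]
  proof (rule SUP_least)
    fix q
    have "q \<bullet> v - \<alpha> * c v \<le> finite_conj (\<lambda>v. \<alpha> * c v) M q"
      using assms by (rule finite_conj_ge)
    then show "ereal (v \<bullet> q - finite_conj (\<lambda>v. \<alpha> * c v) M q) \<le> ereal (\<alpha> * c v)"
      by (simp add: inner_commute)
  qed
qed

text \<open>
  Stated with real upper bounds, so that no arithmetic with infinite values arises.
\<close>

lemma penalty_convex:
  assumes "finite M" "M \<noteq> {}" "0 \<le> t" "t \<le> 1"
    and "penalty \<alpha> c M x \<le> ereal r" "penalty \<alpha> c M y \<le> ereal s"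
  shows "penalty \<alpha> c M ((1 - t) *\<^sub>R x + t *\<^sub>R y) \<le> ereal ((1 - t) * r + t * s)"
  unfolding penalty_eq_SUP[OF assms(1,2)]
proof (rule SUP_least)
  fix q
  let ?f = "finite_conj (\<lambda>v. \<alpha> * c v) M q"
  have "x \<bullet> q - ?f \<le> r" "y \<bullet> q - ?f \<le> s"
    using penalty_Fenchel_Young[OF assms(1,2), of _ q \<alpha> c] assms(5,6)
    by (metis order_trans ereal_less_eq(3))+
  then have "(1 - t) * (x \<bullet> q - ?f) + t * (y \<bullet> q - ?f) \<le> (1 - t) * r + t * s"
    using assms(3,4) by (intro add_mono mult_left_mono) auto
  then show "ereal (((1 - t) *\<^sub>R x + t *\<^sub>R y) \<bullet> q - ?f) \<le> ereal ((1 - t) * r + t * s)"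
    by (simp add: inner_add_left algebra_simps)
qed

text \<open>
  A supremum of continuous functions is lower semicontinuous, so its strict superlevel sets
  are open.
\<close>

lemma penalty_borel_measurable:
  fixes M :: "'a::real_inner set"
  assumes "finite M" "M \<noteq> {}"
  shows "penalty \<alpha> c M \<in> borel_measurable borel"
proof (rule borel_measurableI_greater)
  fix a
  let ?f = "\<lambda>q x. ereal (x \<bullet> q - finite_conj (\<lambda>v. \<alpha> * c v) M q)"
  have "{x. a < penalty \<alpha> c M x} = (\<Union>q. {x. a < ?f q x})"
    unfolding penalty_eq_SUP[OF assms] by (auto simp: less_SUP_iff)
  also have "open \<dots>"
    by (intro open_UN ballI open_Collect_less continuous_intros)
  finally show "{x \<in> space borel. a < penalty \<alpha> c M x} \<in> sets borel"
    by simp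
qed

text \<open>
  Conjugating three times is the same as conjugating once: the penalty lies above the affine
  functions \<open>x \<mapsto> x \<bullet> q - \<psi> q\<close> that define it and, on \<open>M\<close>, below \<open>\<alpha> c\<close>. Hence the conjugate
  penalty is the piecewise affine function \<open>\<psi> = finite_conj (\<lambda>v. \<alpha> * c v) M\<close>.
\<close>

lemma conjugate_penalty:
  assumes "finite M" "M \<noteq> {}"
  shows "conjugate (penalty \<alpha> c M) q = ereal (finite_conj (\<lambda>v. \<alpha> * c v) M q)"
proof (rule antisym)
  show "conjugate (penalty \<alpha> c M) q \<le> ereal (finite_conj (\<lambda>v. \<alpha> * c v) M q)"
    unfolding conjugate_on_def
  proof (rule SUP_least)
    fix x
    show "ereal (q \<bullet> x) - penalty \<alpha> c M x \<le> ereal (finite_conj (\<lambda>v. \<alpha> * c v) M q)"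
      using penalty_Fenchel_Young[OF assms, of x q \<alpha> c]
      by (cases "penalty \<alpha> c M x") (auto simp: inner_commute)
  qed
next
  obtain v where v: "v \<in> M" "finite_conj (\<lambda>v. \<alpha> * c v) M q = q \<bullet> v - \<alpha> * c v"
    using finite_conj_attained[OF assms] .
  show "ereal (finite_conj (\<lambda>v. \<alpha> * c v) M q) \<le> conjugate (penalty \<alpha> c M) q"
    unfolding conjugate_on_def
    using penalty_le_on_M[OF assms(1) v(1), of \<alpha> c]
    by (intro SUP_upper2[of v]; cases "penalty \<alpha> c M v") (auto simp: v)
qed

lemma subdiff_conjugate_penalty_iff:
  fixes \<alpha> :: real and c :: "'a::real_inner \<Rightarrow> real"
  assumes "finite M" "M \<noteq> {}"
  defines "\<psi> \<equiv> finite_conj (\<lambda>v. \<alpha> * c v) M"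
  shows "u \<in> subdiff (conjugate (penalty \<alpha> c M)) q \<longleftrightarrow> (\<forall>q'. \<psi> q + u \<bullet> (q' - q) \<le> \<psi> q')"
  by (simp add: subdiff_on_def conjugate_penalty[OF assms(1,2)] \<psi>_def)

lemma active_in_subdiff:
  assumes "finite M" "v \<in> M" "finite_conj (\<lambda>v. \<alpha> * c v) M q = q \<bullet> v - \<alpha> * c v"
  shows "v \<in> subdiff (conjugate (penalty \<alpha> c M)) q"
proof -
  have M: "M \<noteq> {}" using assms by auto
  have "q' \<bullet> v - \<alpha> * c v \<le> finite_conj (\<lambda>v. \<alpha> * c v) M q'" for q'
    using assms(1,2) by (rule finite_conj_ge)
  then show ?thesis
    unfolding subdiff_conjugate_penalty_iff[OF assms(1) M]
    by (simp add: assms(3) inner_diff_right inner_commute)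
qed

text \<open>
  Strict inequality is essential: it makes the region open, which turns uniqueness of the
  maximizer at one point into uniqueness nearby.
\<close>

definition dominance :: "('a::real_inner \<Rightarrow> real) \<Rightarrow> 'a set \<Rightarrow> 'a \<Rightarrow> 'a set" where
  "dominance b M v = {q. \<forall>w\<in>M - {v}. q \<bullet> w - b w < q \<bullet> v - b v}"

lemma open_dominance: "finite M \<Longrightarrow> open (dominance b M v)"
proof -
  assume M: "finite M"
  have "dominance b M v = (\<Inter>w\<in>M - {v}. {q. q \<bullet> w - b w < q \<bullet> v - b v})"
    by (auto simp: dominance_def)
  also have "open \<dots>"
    using M by (intro open_INT ballI open_Collect_less continuous_intros) auto
  finally show ?thesis .
qed

lemma finite_conj_dominance:
  assumes "finite M" "v \<in> M" "q \<in> dominance b M v"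
  shows "finite_conj b M q = q \<bullet> v - b v"
  unfolding finite_conj_def
proof (rule Max_eqI)
  fix y assume "y \<in> (\<lambda>v. q \<bullet> v - b v) ` M"
  then obtain w where "w \<in> M" "y = q \<bullet> w - b w"
    by blast
  then show "y \<le> q \<bullet> v - b v"
    using assms(3) by (cases "w = v") (auto simp: dominance_def intro: less_imp_le)
qed (use assms in auto)

text \<open>
  Around a point of the region of \<open>v\<close> the conjugate penalty is affine with slope \<open>v\<close>. Moving a
  little in the direction \<open>u - v\<close> then tests the subgradient inequality for \<open>u\<close> and leaves
  \<open>(u - v) \<bullet> (u - v) \<le> 0\<close>.
\<close>

lemma subgradient_dominance:
  assumes "finite M" "v \<in> M" "q \<in> dominance (\<lambda>v. \<alpha> * c v) M v"
    and u: "u \<in> subdiff (conjugate (penalty \<alpha> c M)) q"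
  shows "u = v"
proof -
  have M: "M \<noteq> {}" using assms by auto
  obtain e where e: "e > 0" "ball q e \<subseteq> dominance (\<lambda>v. \<alpha> * c v) M v"
    using open_dominance[OF assms(1)] assms(3) by (meson open_contains_ball)
  \<comment> \<open>The step \<open>t (u - v)\<close> has length less than \<open>e\<close>, also when \<open>u = v\<close>.\<close>
  define t where "t = e / (1 + norm (u - v))"
  have "t > 0"
    using e(1) by (simp add: t_def add_pos_nonneg)
  have "norm (t *\<^sub>R (u - v)) < e"
    using e(1) by (simp add: t_def divide_simps add_pos_nonneg)
  then have "q + t *\<^sub>R (u - v) \<in> dominance (\<lambda>v. \<alpha> * c v) M v"
    using e(2) by (auto simp: dist_norm)
  from finite_conj_dominance[OF assms(1,2) this] finite_conj_dominance[OF assms(1-3)]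
  have "t * (u \<bullet> (u - v)) \<le> t * ((u - v) \<bullet> v)"
    using u[unfolded subdiff_conjugate_penalty_iff[OF assms(1) M], rule_format, of "q + t *\<^sub>R (u - v)"]
    by (simp add: inner_add_left)
  then have "u \<bullet> (u - v) \<le> (u - v) \<bullet> v"
    using \<open>t > 0\<close> by simp
  then have "(u - v) \<bullet> (u - v) \<le> 0"
    by (simp add: inner_diff_left inner_diff_right inner_commute)
  then show ?thesis
    using inner_gt_zero_iff[of "u - v"] by fastforce
qed

text \<open>
  If two elements of \<open>M\<close> attain the maximum at \<open>q\<close>, both of them are subgradients there, so
  a single-valued subdifferential forces a unique maximizer. This identifies the abstract set
  as a finite union of open sets on each of which the only subgradient is a fixed element
  of \<open>M\<close>.
\<close>

lemma single_valued_set_eq: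
  fixes M :: "(real^'m) set"
  assumes "finite M" "M \<noteq> {}"
  shows "single_valued_set (penalty \<alpha> c M) = (\<Union>v\<in>M. dominance (\<lambda>v. \<alpha> * c v) M v)"
proof
  show "(\<Union>v\<in>M. dominance (\<lambda>v. \<alpha> * c v) M v) \<subseteq> single_valued_set (penalty \<alpha> c M)"
  proof
    fix q assume "q \<in> (\<Union>v\<in>M. dominance (\<lambda>v. \<alpha> * c v) M v)"
    then obtain v where v: "v \<in> M" "q \<in> dominance (\<lambda>v. \<alpha> * c v) M v"
      by blast
    have "subdiff (conjugate (penalty \<alpha> c M)) q = {v}"
      using subgradient_dominance[OF assms(1) v] 
        active_in_subdiff[OF assms(1) v(1) finite_conj_dominance[OF assms(1) v]] by blast
    then show "q \<in> single_valued_set (penalty \<alpha> c M)"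
      by (auto simp: single_valued_set_def)
  qed
next
  show "single_valued_set (penalty \<alpha> c M) \<subseteq> (\<Union>v\<in>M. dominance (\<lambda>v. \<alpha> * c v) M v)"
  proof
    fix q assume "q \<in> single_valued_set (penalty \<alpha> c M)"
    then obtain u where u: "subdiff (conjugate (penalty \<alpha> c M)) q = {u}"
      by (auto simp: single_valued_set_def)
    obtain v where v: "v \<in> M" "finite_conj (\<lambda>v. \<alpha> * c v) M q = q \<bullet> v - \<alpha> * c v"
      using finite_conj_attained[OF assms] .
    have "q \<in> dominance (\<lambda>v. \<alpha> * c v) M v"
      unfolding dominance_def
    proof (intro CollectI ballI)
      fix w assume "w \<in> M - {v}"
      then have w: "w \<in> M" "w \<noteq> v"
        by auto
      have "finite_conj (\<lambda>v. \<alpha> * c v) M q \<noteq> q \<bullet> w - \<alpha> * c w"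
        using active_in_subdiff[OF assms(1) w(1)] active_in_subdiff[OF assms(1) v] u w(2) by auto
      then show "q \<bullet> w - \<alpha> * c w < q \<bullet> v - \<alpha> * c v"
        using finite_conj_ge[OF assms(1) w(1), of q "\<lambda>v. \<alpha> * c v"] v(2) by simp
    qed
    then show "q \<in> (\<Union>v\<in>M. dominance (\<lambda>v. \<alpha> * c v) M v)"
      using v(1) by blast
  qed
qed

text \<open>
  The conjugate penalty is Lipschitz with constant \<open>R\<close>; the subgradient inequality in the
  direction \<open>u\<close> itself yields the bound. It provides the dominating function below.
\<close>

lemma subgradient_norm_le:
  assumes "finite M" "M \<noteq> {}" and R: "\<And>v. v \<in> M \<Longrightarrow> norm v \<le> R"
    and u: "u \<in> subdiff (conjugate (penalty \<alpha> c M)) q"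
  shows "norm u \<le> R"
proof -
  let ?\<psi> = "finite_conj (\<lambda>v. \<alpha> * c v) M"
  obtain v where v: "v \<in> M" "?\<psi> (q + u) = (q + u) \<bullet> v - \<alpha> * c v"
    using finite_conj_attained[OF assms(1,2)] .
  have "?\<psi> q + u \<bullet> u \<le> ?\<psi> (q + u)"
    using u[unfolded subdiff_conjugate_penalty_iff[OF assms(1,2)], rule_format, of "q + u"] by simp
  also have "\<dots> \<le> ?\<psi> q + u \<bullet> v"
    using finite_conj_ge[OF assms(1) v(1), of q "\<lambda>v. \<alpha> * c v"] by (simp add: v(2) inner_add_left)
  also have "u \<bullet> v \<le> norm u * norm v"
    by (rule norm_cauchy_schwarz)
  also have "\<dots> \<le> norm u * R"
    using R[OF v(1)] by (simp add: mult_left_mono)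
  finally have "norm u * norm u \<le> norm u * R"
    by (simp add: power2_norm_eq_inner flip: power2_eq_square)
  moreover have "0 \<le> R"
    using R[OF v(1)] norm_ge_zero order_trans by blast
  ultimately show ?thesis
    by (cases "u = 0") auto
qed

text \<open>
  Equality in the Fenchel--Young inequality characterizes subgradients. Since the conjugate
  penalty is a maximum over \<open>M\<close>, comparing \<open>u\<close> with the finitely many elements of \<open>M\<close>
  suffices. This is why the first-order condition need only be tested with values in \<open>M\<close>.
\<close>

lemma subgradient_from_M:
  assumes "finite M" "M \<noteq> {}" and "penalty \<alpha> c M u \<le> ereal r"
    and "\<And>v. v \<in> M \<Longrightarrow> q \<bullet> v - \<alpha> * c v \<le> q \<bullet> u - r"
  shows "u \<in> subdiff (conjugate (penalty \<alpha> c M)) q"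
  unfolding subdiff_conjugate_penalty_iff[OF assms(1,2)]
proof
  fix q'
  let ?\<psi> = "finite_conj (\<lambda>v. \<alpha> * c v) M"
  have "?\<psi> q \<le> q \<bullet> u - r"
    using finite_conj_attained[OF assms(1,2)] assms(4) by metis
  moreover have "u \<bullet> q' - ?\<psi> q' \<le> r"
    using order_trans[OF penalty_Fenchel_Young[OF assms(1,2)] assms(3)] by simp
  ultimately show "?\<psi> q + u \<bullet> (q' - q) \<le> ?\<psi> q'"
    by (simp add: inner_diff_right inner_commute)
qed

section \<open>Calculus on \<open>L\<^sup>2\<close> and the integral functional\<close>

lemma L2D:
  assumes "u \<in> L2 \<Omega>"
  shows "u \<in> borel_measurable (lebesgue_on \<Omega>)" "integrable (lebesgue_on \<Omega>) (\<lambda>x. (norm (u x))\<^sup>2)"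
  using assms by (auto simp: L2_def)

lemma L2_integrable_inner:
  fixes u v :: "real^'n \<Rightarrow> real^'m"
  assumes "u \<in> L2 \<Omega>" "v \<in> L2 \<Omega>"
  shows "integrable (lebesgue_on \<Omega>) (\<lambda>x. u x \<bullet> v x)"
proof (rule Bochner_Integration.integrable_bound)
  show "integrable (lebesgue_on \<Omega>) (\<lambda>x. (norm (u x))\<^sup>2 + (norm (v x))\<^sup>2)"
    using L2D(2)[OF assms(1)] L2D(2)[OF assms(2)] by simp
  show "(\<lambda>x. u x \<bullet> v x) \<in> borel_measurable (lebesgue_on \<Omega>)"
    using L2D(1)[OF assms(1)] L2D(1)[OF assms(2)] by measurable
  have "norm (a \<bullet> b) \<le> norm ((norm a)\<^sup>2 + (norm b)\<^sup>2)" for a b :: "real^'m"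
  proof -
    have "norm (a \<bullet> b) \<le> norm a * norm b"
      by (simp add: Cauchy_Schwarz_ineq2)
    also have "\<dots> \<le> (norm a)\<^sup>2 + (norm b)\<^sup>2"
      using sum_squares_bound[of "norm a" "norm b"] mult_nonneg_nonneg[OF norm_ge_zero norm_ge_zero, of a b]
      by linarith
    finally show ?thesis
      by simp
  qed
  then show "AE x in lebesgue_on \<Omega>. norm (u x \<bullet> v x) \<le> norm ((norm (u x))\<^sup>2 + (norm (v x))\<^sup>2)"
    by simp
qed

lemma L2_scaleR: "u \<in> L2 \<Omega> \<Longrightarrow> (\<lambda>x. r *\<^sub>R u x) \<in> L2 \<Omega>"
  by (auto simp: L2_def power_mult_distrib)

lemma L2_add:
  assumes "u \<in> L2 \<Omega>" "v \<in> L2 \<Omega>"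
  shows "(\<lambda>x. u x + v x) \<in> L2 \<Omega>"
proof -
  have "(norm (u x + v x))\<^sup>2 = (norm (u x))\<^sup>2 + (norm (v x))\<^sup>2 + 2 * (u x \<bullet> v x)" for x
    by (simp add: power2_norm_eq_inner inner_add_left inner_add_right inner_commute)
  then have "integrable (lebesgue_on \<Omega>) (\<lambda>x. (norm (u x + v x))\<^sup>2)"
    using L2D(2)[OF assms(1)] L2D(2)[OF assms(2)] L2_integrable_inner[OF assms] by simp
  then show ?thesis
    using L2D(1)[OF assms(1)] L2D(1)[OF assms(2)] by (simp add: L2_def)
qed

lemma L2_diff: "u \<in> L2 \<Omega> \<Longrightarrow> v \<in> L2 \<Omega> \<Longrightarrow> (\<lambda>x. u x - v x) \<in> L2 \<Omega>"
  using L2_add[of u \<Omega> "\<lambda>x. (-1) *\<^sub>R v x"] L2_scaleR[of v \<Omega> "-1"] by simp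

lemma L2_const:
  fixes \<Omega> :: "(real^'n) set"
  assumes "\<Omega> \<in> lmeasurable"
  shows "(\<lambda>x. v) \<in> L2 \<Omega>"
  using finite_measure.integrable_const[OF finite_measure_lebesgue_on[OF assms]]
  by (simp add: L2_def)

lemma L2_indicator:
  assumes "u \<in> L2 \<Omega>" "A \<in> sets (lebesgue_on \<Omega>)"
  shows "(\<lambda>x. indicator A x *\<^sub>R u x) \<in> L2 \<Omega>"
proof -
  have "(norm (indicator A x *\<^sub>R u x))\<^sup>2 = indicator A x * (norm (u x))\<^sup>2" for x
    by (simp add: indicator_def)
  then show ?thesis
    using L2D[OF assms(1)] assms(2) integrable_mult_indicator[OF assms(2) L2D(2)[OF assms(1)]]
    by (simp add: L2_def)
qed

lemma L2_inner_cong_right: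
  assumes "L2_eq \<Omega> v w" "u \<in> L2 \<Omega>" "v \<in> L2 \<Omega>" "w \<in> L2 \<Omega>"
  shows "L2_inner \<Omega> u v = L2_inner \<Omega> u w"
  unfolding L2_inner_def
  using assms(1) L2_integrable_inner[OF assms(2,3)] L2_integrable_inner[OF assms(2,4)]
  by (intro integral_cong_AE) (auto simp: L2_eq_def elim: AE_mp)

lemma L2_inner_minus_right: "L2_inner \<Omega> u (\<lambda>x. - v x) = - L2_inner \<Omega> u v"
  by (simp add: L2_inner_def)

lemma L2_cong:
  assumes "L2_eq \<Omega> v w" "w \<in> L2 \<Omega>" "v \<in> borel_measurable (lebesgue_on \<Omega>)"
  shows "v \<in> L2 \<Omega>"
proof -
  have "integrable (lebesgue_on \<Omega>) (\<lambda>x. (norm (v x))\<^sup>2)"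
    using assms(1,3) L2D[OF assms(2)]
    by (subst integrable_cong_AE[where g = "\<lambda>x. (norm (w x))\<^sup>2"]) (auto simp: L2_eq_def elim: AE_mp)
  with assms(3) show ?thesis
    by (simp add: L2_def)
qed

text \<open>
  Reduces differentiability on \<open>L\<^sup>2\<close> to the calculus of one real variable.
\<close>

lemma L2_has_derivative_along_line:
  assumes D: "L2_has_derivative \<Omega> S D u" and h: "h \<in> L2 \<Omega>"
  shows "((\<lambda>t. S (\<lambda>x. u x + t *\<^sub>R h x)) has_vector_derivative D h) (at 0)"
  unfolding has_vector_derivative_def has_derivative_at_alt
proof (intro conjI allI impI)
  show "bounded_linear (\<lambda>t. t *\<^sub>R D h)"
    by (rule bounded_linear_scaleR_left)
  fix e :: real assume "e > 0"
  \<comment> \<open>Adding 1 keeps the divisor positive when \<open>h\<close> vanishes almost everywhere.\<close>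
  define K where "K = 1 + L2_norm \<Omega> h"
  have K: "K > 0" "L2_norm \<Omega> h \<ge> 0" "L2_norm \<Omega> h \<le> K"
    by (auto simp: K_def L2_norm_def L2_inner_def add_pos_nonneg)
  have "e / K > 0" using \<open>e > 0\<close> K by simp
  then obtain d where d: "d > 0" "\<And>k. k \<in> L2 \<Omega> \<Longrightarrow> L2_norm \<Omega> k < d \<Longrightarrow>
      norm (S (\<lambda>x. u x + k x) - S u - D k) \<le> e / K * L2_norm \<Omega> k"
    using D[unfolded L2_has_derivative_def, THEN conjunct2, rule_format, of "e / K"] by blast
  have norm_scale: "L2_norm \<Omega> (\<lambda>x. t *\<^sub>R h x) = \<bar>t\<bar> * L2_norm \<Omega> h" for t
  proof -
    have "L2_inner \<Omega> (\<lambda>x. t *\<^sub>R h x) (\<lambda>x. t *\<^sub>R h x) = t\<^sup>2 * L2_inner \<Omega> h h"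
      by (simp add: L2_inner_def power2_eq_square)
    then show ?thesis
      by (simp add: L2_norm_def real_sqrt_mult)
  qed
  have D_scale: "D (\<lambda>x. t *\<^sub>R h x) = t *\<^sub>R D h" for t
    using D h by (auto simp: L2_has_derivative_def L2_bounded_linear_def)
  show "\<exists>d>0. \<forall>t. norm (t - 0) < d \<longrightarrow>
      norm (S (\<lambda>x. u x + t *\<^sub>R h x) - S (\<lambda>x. u x + 0 *\<^sub>R h x) - (t - 0) *\<^sub>R D h) \<le> e * norm (t - 0)"
  proof (intro exI[of _ "d / K"] conjI allI impI)
    show "d / K > 0" using d K by simp
    fix t :: real assume "norm (t - 0) < d / K"
    then have "\<bar>t\<bar> * K < d" using K by (simp add: pos_less_divide_eq)
    then have "\<bar>t\<bar> * L2_norm \<Omega> h < d"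
      using mult_left_mono[OF K(3), of "\<bar>t\<bar>"] by simp
    then have "norm (S (\<lambda>x. u x + t *\<^sub>R h x) - S u - t *\<^sub>R D h) \<le> e / K * (\<bar>t\<bar> * L2_norm \<Omega> h)"
      using d(2)[OF L2_scaleR[OF h], of t] by (simp add: norm_scale D_scale)
    also have "\<dots> \<le> e / K * (\<bar>t\<bar> * K)"
      using K \<open>e > 0\<close> by (intro mult_left_mono) auto
    finally show "norm (S (\<lambda>x. u x + t *\<^sub>R h x) - S (\<lambda>x. u x + 0 *\<^sub>R h x) - (t - 0) *\<^sub>R D h)
        \<le> e * norm (t - 0)"
      using K by simp
  qed
qed

lemma integral_functional_le:
  assumes "integrable (lebesgue_on \<Omega>) f" "\<And>x. 0 \<le> f x"
    and "AE x in lebesgue_on \<Omega>. g (w x) \<le> ereal (f x)"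
  shows "integral_functional \<Omega> g w \<le> ereal (LINT x|lebesgue_on \<Omega>. f x)"
proof -
  have "(\<integral>\<^sup>+x. e2ennreal (g (w x)) \<partial>lebesgue_on \<Omega>) \<le> (\<integral>\<^sup>+x. ennreal (f x) \<partial>lebesgue_on \<Omega>)"
  proof (rule nn_integral_mono_AE)
    show "AE x in lebesgue_on \<Omega>. e2ennreal (g (w x)) \<le> ennreal (f x)"
      using assms(3)
    proof eventually_elim
      case (elim x)
      from e2ennreal_mono[OF this] show ?case
        by simp
    qed
  qed
  also have "\<dots> = ennreal (LINT x|lebesgue_on \<Omega>. f x)"
    using assms by (intro nn_integral_eq_integral) auto
  finally have "integral_functional \<Omega> g w \<le> enn2ereal (ennreal (LINT x|lebesgue_on \<Omega>. f x))"
    unfolding integral_functional_def by (simp add: less_eq_ennreal.rep_eq)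
  then show ?thesis
    using assms(2) by (simp add: enn2ereal_ennreal)
qed

lemma integral_functional_finite:
  assumes g: "g \<in> borel_measurable borel" "\<And>v. 0 \<le> g v"
    and u: "u \<in> borel_measurable (lebesgue_on \<Omega>)"
    and fin: "integral_functional \<Omega> g u < \<infinity>"
  defines "\<gamma> \<equiv> \<lambda>x. real_of_ereal (g (u x))"
  shows "AE x in lebesgue_on \<Omega>. g (u x) = ereal (\<gamma> x)"
    and "integrable (lebesgue_on \<Omega>) \<gamma>"
    and "integral_functional \<Omega> g u = ereal (LINT x|lebesgue_on \<Omega>. \<gamma> x)"
proof -
  have [measurable]: "g \<in> borel_measurable borel" "u \<in> borel_measurable (lebesgue_on \<Omega>)"
    by fact+
  have m: "(\<lambda>x. e2ennreal (g (u x))) \<in> borel_measurable (lebesgue_on \<Omega>)"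
    by measurable
  have "(\<integral>\<^sup>+x. e2ennreal (g (u x)) \<partial>lebesgue_on \<Omega>) \<noteq> \<infinity>"
    using fin by (auto simp: integral_functional_def)
  then have "AE x in lebesgue_on \<Omega>. e2ennreal (g (u x)) \<noteq> \<infinity>"
    by (rule nn_integral_PInf_AE[OF m])
  then show ae: "AE x in lebesgue_on \<Omega>. g (u x) = ereal (\<gamma> x)"
  proof eventually_elim
    case (elim x)
    then show ?case
      using g(2)[of "u x"] by (cases "g (u x)") (auto simp: \<gamma>_def)
  qed
  have nn: "0 \<le> \<gamma> x" for x
    using g(2) by (simp add: \<gamma>_def real_of_ereal_pos)
  have "(\<integral>\<^sup>+x. e2ennreal (g (u x)) \<partial>lebesgue_on \<Omega>) = (\<integral>\<^sup>+x. ennreal (\<gamma> x) \<partial>lebesgue_on \<Omega>)"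
    using ae by (intro nn_integral_cong_AE) (auto elim!: AE_mp)
  note eq = this
  show int: "integrable (lebesgue_on \<Omega>) \<gamma>"
  proof (rule integrableI_nonneg)
    show "\<gamma> \<in> borel_measurable (lebesgue_on \<Omega>)"
      unfolding \<gamma>_def by measurable
    show "(\<integral>\<^sup>+x. ennreal (\<gamma> x) \<partial>lebesgue_on \<Omega>) < \<infinity>"
      using \<open>_ \<noteq> \<infinity>\<close> eq by (simp add: top.not_eq_extremum)
  qed (simp add: nn)
  show "integral_functional \<Omega> g u = ereal (LINT x|lebesgue_on \<Omega>. \<gamma> x)"
    unfolding integral_functional_def eq
    using nn by (subst nn_integral_eq_integral[OF int]) (auto simp: enn2ereal_ennreal)
qed

section \<open>Pointwise optimality of minimizers\<close>

text \<open>
  The first-order condition, localized to points. The minimizer \<open>u\<close> is perturbed towards the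
  constant \<open>v \<in> M\<close> on a measurable set \<open>A\<close> only, i.e. in the direction
  \<open>h = 1\<^sub>A (v - u)\<close>. Convexity of the penalty bounds the change of the integral
  functional by \<open>t \<integral>\<^sub>A (\<alpha> c v - g u)\<close>, and the derivative of the tracking term along \<open>h\<close> is
  \<open>- \<integral> h \<bullet> q\<close>. Minimality therefore gives
  \<open>\<integral>\<^sub>A (\<alpha> c v - g u - (v - u) \<bullet> q) \<ge> 0\<close> for every measurable \<open>A\<close>, so the integrand is
  non-negative almost everywhere. As \<open>M\<close> is finite, this holds for all \<open>v \<in> M\<close> at once, which
  is the pointwise criterion for a subgradient.
\<close>

lemma minimizer_subgradient:
  fixes \<Omega> :: "(real^'n) set" and M :: "(real^'m) set"
    and S :: "(real^'n \<Rightarrow> real^'m) \<Rightarrow> 'y::real_inner"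
  assumes \<Omega>: "\<Omega> \<in> lmeasurable" and M: "finite M" "M \<noteq> {}"
    and \<alpha>: "\<alpha> > 0" and c: "\<And>v. c v \<ge> 0"
    and min: "is_arg_min (energy \<Omega> (penalty \<alpha> c M) S z) (\<lambda>w. w \<in> L2 \<Omega>) u"
    and D: "L2_has_derivative \<Omega> S D u"
    and q: "q \<in> L2 \<Omega>" "\<And>h. h \<in> L2 \<Omega> \<Longrightarrow> D h \<bullet> (z - S u) = L2_inner \<Omega> h q"
  shows "AE x in lebesgue_on \<Omega>. u x \<in> subdiff (conjugate (penalty \<alpha> c M)) (q x)"
proof -
  let ?g = "penalty \<alpha> c M" and ?N = "lebesgue_on \<Omega>"
  define b where "b v = \<alpha> * c v" for v
  have b: "0 \<le> b v" for v
    using \<alpha> c by (simp add: b_def)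
  have u: "u \<in> L2 \<Omega>"
    using min by (simp add: is_arg_min_def)
  have energy_le: "energy \<Omega> ?g S z u \<le> energy \<Omega> ?g S z w" if "w \<in> L2 \<Omega>" for w
    using min that by (auto simp: is_arg_min_def not_less)
  interpret finite_measure ?N
    using \<Omega> by (rule finite_measure_lebesgue_on)
  \<comment> \<open>Constants in \<open>M\<close> have finite energy, so the energy of the minimizer is finite as well.\<close>
  obtain v0 where v0: "v0 \<in> M"
    using M(2) by blast
  have "integral_functional \<Omega> ?g (\<lambda>x. v0) \<le> ereal (LINT x|?N. b v0)"
    using b penalty_le_on_M[OF M(1) v0, of \<alpha> c]
    by (intro integral_functional_le) (auto simp: b_def)
  then have "energy \<Omega> ?g S z (\<lambda>x. v0) < \<infinity>"
    by (auto simp: energy_def)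
  then have "energy \<Omega> ?g S z u < \<infinity>"
    using energy_le[OF L2_const[OF \<Omega>]] le_less_trans by blast
  then have "integral_functional \<Omega> ?g u < \<infinity>"
    by (auto simp: energy_def)
  define \<gamma> where "\<gamma> x = real_of_ereal (?g (u x))" for x
  note fin = integral_functional_finite[OF penalty_borel_measurable[OF M]
      penalty_nonneg[OF \<alpha> c] L2D(1)[OF u] \<open>integral_functional \<Omega> ?g u < \<infinity>\<close>, folded \<gamma>_def]
  have \<gamma>_nonneg: "0 \<le> \<gamma> x" for x
    unfolding \<gamma>_def by (rule real_of_ereal_pos[OF penalty_nonneg[OF \<alpha> c]])

  have pointwise: "AE x in ?N. 0 \<le> b v - \<gamma> x - (v - u x) \<bullet> q x" if v: "v \<in> M" for v
  proof (rule density_nonneg)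
    have vu: "(\<lambda>x. v - u x) \<in> L2 \<Omega>"
      by (intro L2_diff L2_const[OF \<Omega>] u)
    show int: "integrable ?N (\<lambda>x. b v - \<gamma> x - (v - u x) \<bullet> q x)"
      using fin(2) L2_integrable_inner[OF vu q(1)] by simp
    fix A assume A: "A \<in> sets ?N"
    define h where "h x = indicator A x *\<^sub>R (v - u x)" for x
    define K where "K = (LINT x|?N. indicator A x * (b v - \<gamma> x))"
    have h: "h \<in> L2 \<Omega>"
      unfolding h_def by (rule L2_indicator[OF vu A])
    have int_A: "integrable ?N (\<lambda>x. indicator A x * (b v - \<gamma> x))"
      using integrable_mult_indicator[OF A, of "\<lambda>x. b v - \<gamma> x"] fin(2) by simp
    \<comment> \<open>An upper bound for the energy along the perturbation, up to the constant \<open>\<integral> g u\<close>.\<close>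
    define \<phi> where "\<phi> t = 1/2 * (norm (S (\<lambda>x. u x + t *\<^sub>R h x) - z))\<^sup>2 + t * K" for t
    have \<phi>_min: "\<phi> 0 \<le> \<phi> t" if t: "0 \<le> t" "t \<le> 1" for t
    proof -
      let ?w = "\<lambda>x. u x + t *\<^sub>R h x" and ?f = "\<lambda>x. \<gamma> x + t * (indicator A x * (b v - \<gamma> x))"
      have "integral_functional \<Omega> ?g ?w \<le> ereal (LINT x|?N. ?f x)"
      proof (rule integral_functional_le)
        show "integrable ?N ?f"
          using fin(2) int_A by simp
        show "0 \<le> ?f x" for x
        proof (cases "x \<in> A")
          case True
          have "?f x = (1 - t) * \<gamma> x + t * b v"
            using True by (simp add: algebra_simps)
          then show ?thesis
            using t b \<gamma>_nonneg by simp
        qed (simp add: \<gamma>_nonneg)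
        show "AE x in ?N. ?g (?w x) \<le> ereal (?f x)"
          using fin(1)
        proof eventually_elim
          case (elim x)
          show ?case
          proof (cases "x \<in> A")
            case True
            have "?g ((1 - t) *\<^sub>R u x + t *\<^sub>R v) \<le> ereal ((1 - t) * \<gamma> x + t * b v)"
              using elim t penalty_le_on_M[OF M(1) v, of \<alpha> c]
              by (intro penalty_convex[OF M]) (auto simp: b_def)
            then show ?thesis
              using True by (simp add: h_def algebra_simps)
          qed (use elim in \<open>simp add: h_def\<close>)
        qed
      qed
      also have "(LINT x|?N. ?f x) = (LINT x|?N. \<gamma> x) + t * K"
        unfolding K_def using fin(2) int_A by simp
      finally have "energy \<Omega> ?g S z ?w
          \<le> ereal (1/2 * (norm (S ?w - z))\<^sup>2) + ereal ((LINT x|?N. \<gamma> x) + t * K)"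
        unfolding energy_def by (rule add_left_mono)
      moreover have "energy \<Omega> ?g S z u \<le> energy \<Omega> ?g S z ?w"
        by (intro energy_le L2_add u L2_scaleR h)
      moreover have "energy \<Omega> ?g S z u = ereal (1/2 * (norm (S u - z))\<^sup>2 + (LINT x|?N. \<gamma> x))"
        unfolding energy_def fin(3) by simp
      ultimately show ?thesis
        by (auto simp: \<phi>_def dest: order_trans)
    qed
    define r where "r t = S (\<lambda>x. u x + t *\<^sub>R h x) - z" for t
    have "((\<lambda>t. S (\<lambda>x. u x + t *\<^sub>R h x)) has_vector_derivative D h) (at 0)"
      by (rule L2_has_derivative_along_line[OF D h])
    then have r: "(r has_derivative (\<lambda>t. t *\<^sub>R D h)) (at 0)"
      unfolding r_def[abs_def] has_vector_derivative_def by (auto intro!: derivative_eq_intros)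
    have "\<phi> = (\<lambda>t. 1/2 * (r t \<bullet> r t) + t * K)"
      by (simp add: fun_eq_iff \<phi>_def r_def power2_norm_eq_inner)
    moreover have "((\<lambda>t. 1/2 * (r t \<bullet> r t) + t * K) has_derivative
        (\<lambda>t. 1/2 * (r 0 \<bullet> (t *\<^sub>R D h) + (t *\<^sub>R D h) \<bullet> r 0) + t * K)) (at 0)"
      by (intro has_derivative_add has_derivative_mult_right has_derivative_mult_left
          has_derivative_inner has_derivative_ident r)
    moreover have "(\<lambda>t. 1/2 * (r 0 \<bullet> (t *\<^sub>R D h) + (t *\<^sub>R D h) \<bullet> r 0) + t * K)
        = (*) ((S u - z) \<bullet> D h + K)"
      by (simp add: fun_eq_iff r_def inner_commute algebra_simps)
    ultimately have deriv: "DERIV \<phi> 0 :> (S u - z) \<bullet> D h + K"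
      by (simp add: has_field_derivative_def)
    have "0 \<le> (S u - z) \<bullet> D h + K"
    proof (rule ccontr)
      assume "\<not> ?thesis"
      then obtain d where d: "d > 0" "\<And>t. 0 < t \<Longrightarrow> t < d \<Longrightarrow> \<phi> t < \<phi> 0"
        using DERIV_neg_dec_right[OF deriv] by auto
      define t where "t = min 1 (d / 2)"
      have "0 < t" "t < d" "t \<le> 1"
        using d(1) by (auto simp: t_def)
      with d(2)[of t] \<phi>_min[of t] show False
        by simp
    qed
    moreover have "D h \<bullet> (z - S u) = - ((S u - z) \<bullet> D h)"
      by (simp add: inner_diff_left inner_diff_right inner_commute)
    ultimately have "0 \<le> K - L2_inner \<Omega> h q"
      using q(2)[OF h] by linarith
    also have "K - L2_inner \<Omega> h q = (LINT x|?N. indicator A x * (b v - \<gamma> x) - h x \<bullet> q x)"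
      unfolding K_def L2_inner_def
      by (rule Bochner_Integration.integral_diff[OF int_A L2_integrable_inner[OF h q(1)], symmetric])
    also have "\<dots> = set_lebesgue_integral ?N A (\<lambda>x. b v - \<gamma> x - (v - u x) \<bullet> q x)"
      unfolding set_lebesgue_integral_def
      by (rule Bochner_Integration.integral_cong) (auto simp: h_def indicator_def)
    finally show "0 \<le> set_lebesgue_integral ?N A (\<lambda>x. b v - \<gamma> x - (v - u x) \<bullet> q x)" .
  qed
  have "AE x in ?N. \<forall>v\<in>M. 0 \<le> b v - \<gamma> x - (v - u x) \<bullet> q x"
    using M(1) pointwise by (subst AE_finite_all) auto
  then show ?thesis
    using fin(1)
  proof eventually_elim
    case (elim x)
    show ?case
    proof (rule subgradient_from_M[OF M])
      show "?g (u x) \<le> ereal (\<gamma> x)"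
        using elim by simp
      show "q x \<bullet> v - \<alpha> * c v \<le> q x \<bullet> u x - \<gamma> x" if "v \<in> M" for v
      proof -
        have "0 \<le> b v - \<gamma> x - (v - u x) \<bullet> q x"
          using elim(1) that by blast
        then show ?thesis
          by (simp add: b_def inner_diff_left inner_commute[of "q x"])
      qed
    qed
  qed
qed

section \<open>Level sets of the dual variable and convergence of minimizers\<close>

lemma Omega_part_sets:
  assumes "q \<in> borel_measurable (lebesgue_on \<Omega>)" "B \<in> sets borel"
  shows "Omega_part \<Omega> q B \<in> sets (lebesgue_on \<Omega>)"
proof -
  have "Omega_part \<Omega> q B = q -` B \<inter> space (lebesgue_on \<Omega>)"
    by (auto simp: Omega_part_def)
  then show ?thesis
    using measurable_sets[OF assms] by simp
qed

text \<open>
  Lebesgue measure on a level set is the restriction of Lebesgue measure on \<open>\<Omega>\<close>, so that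
  almost-everywhere statements pass between the two.
\<close>

lemma lebesgue_on_Omega_part:
  assumes "\<Omega> \<in> sets lebesgue" "q \<in> borel_measurable (lebesgue_on \<Omega>)" "B \<in> sets borel"
  shows "lebesgue_on (Omega_part \<Omega> q B) = restrict_space (lebesgue_on \<Omega>) (Omega_part \<Omega> q B)"
proof -
  have sub: "\<Omega> \<inter> Omega_part \<Omega> q B = Omega_part \<Omega> q B"
    by (auto simp: Omega_part_def)
  have "Omega_part \<Omega> q B \<in> sets lebesgue"
    using Omega_part_sets[OF assms(2,3)] assms(1) by (auto simp: sets_restrict_space_iff)
  then show ?thesis
    using assms(1) sub by (simp add: restrict_restrict_space)
qed

lemma AE_Omega_part_iff:
  assumes "\<Omega> \<in> sets lebesgue" "q \<in> borel_measurable (lebesgue_on \<Omega>)" "B \<in> sets borel"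
  shows "(AE x in lebesgue_on (Omega_part \<Omega> q B). R x) \<longleftrightarrow>
         (AE x in lebesgue_on \<Omega>. q x \<in> B \<longrightarrow> R x)"
proof -
  have "(AE x in lebesgue_on (Omega_part \<Omega> q B). R x) \<longleftrightarrow>
        (AE x in lebesgue_on \<Omega>. x \<in> Omega_part \<Omega> q B \<longrightarrow> R x)"
    unfolding lebesgue_on_Omega_part[OF assms]
    using Omega_part_sets[OF assms(2,3)] by (intro AE_restrict_space_iff) auto
  also have "\<dots> \<longleftrightarrow> (AE x in lebesgue_on \<Omega>. q x \<in> B \<longrightarrow> R x)"
    by (intro AE_cong) (auto simp: Omega_part_def)
  finally show ?thesis .
qed

text \<open>
  The embedding is linear only up to null sets that depend on the functionals; what the
  proof needs is that convergence in the dual space is uniform convergence almost everywhere.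
\<close>

lemma dual_Linf_embedding_diff:
  assumes "dual_Linf_embedding \<Omega> \<iota> j"
  obtains C where
    "\<And>w w'. AE x in lebesgue_on \<Omega>. norm (j w x - j w' x) \<le> C * norm (w - w')"
proof -
  note embedding = assms[unfolded dual_Linf_embedding_def, THEN conjunct2]
  obtain C where C: "\<And>w. AE x in lebesgue_on \<Omega>. norm (j w x) \<le> C * norm w"
    using embedding[THEN conjunct1] by blast
  have "AE x in lebesgue_on \<Omega>. norm (j w x - j w' x) \<le> C * norm (w - w')" for w w'
  proof -
    have "AE x in lebesgue_on \<Omega>. j (w - w' + w') x = j (w - w') x + j w' x"
      using embedding[THEN conjunct2, THEN conjunct1] unfolding L2_eq_def by blast
    with C[of "w - w'"] show ?thesis
      by eventually_elim simp
  qed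
  then show ?thesis
    using that by blast
qed

theorem proposition3p4:
  fixes \<Omega> :: "(real^'n) set"
    and S :: "(real^'n \<Rightarrow> real^'m) \<Rightarrow> 'y::{real_inner, complete_space}"
    and S' :: "(real^'n \<Rightarrow> real^'m) \<Rightarrow> (real^'n \<Rightarrow> real^'m) \<Rightarrow> 'y"
    and S'adj :: "(real^'n \<Rightarrow> real^'m) \<Rightarrow> 'y \<Rightarrow> ('v::banach \<Rightarrow>\<^sub>L real)"
    and \<iota> :: "(real^'n \<Rightarrow> real^'m) \<Rightarrow> 'v"
    and j :: "('v \<Rightarrow>\<^sub>L real) \<Rightarrow> real^'n \<Rightarrow> real^'m"
    and M :: "(real^'m) set" and \<alpha> :: real and c :: "real^'m \<Rightarrow> real"
    and g :: "real^'m \<Rightarrow> ereal" and Q :: "(real^'m) set"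
    and zn :: "nat \<Rightarrow> 'y" and z :: 'y
    and u :: "nat \<Rightarrow> real^'n \<Rightarrow> real^'m" and ubar :: "real^'n \<Rightarrow> real^'m"
    and p :: "nat \<Rightarrow> ('v \<Rightarrow>\<^sub>L real)" and pbar :: "'v \<Rightarrow>\<^sub>L real"
  assumes m_ge_2: "CARD('m) \<ge> 2"
    and \<Omega>: "open \<Omega>" "bounded \<Omega>"
    and M: "finite M" "M \<noteq> {}"
    and \<alpha>: "\<alpha> > 0"
    and c: "\<forall>v. c v \<ge> 0" "strictly_convex c" "lower_semicontinuous c"
    and g: "g = penalty \<alpha> c M"
    and Q: "Q = single_valued_set g"
    and S: "L2_well_defined \<Omega> S"
    and z_conv: "zn \<longlonglongrightarrow> z"
    and S_weak: "\<forall>ui w. L2_weakly_tendsto \<Omega> ui w \<longrightarrow> weakly_tendsto (\<lambda>i. S (ui i)) (S w)"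
    and S_diff: "\<forall>w\<in>L2 \<Omega>. L2_has_derivative \<Omega> S (S' w) w"
    and S_compact: "L2_compact_operator \<Omega> S"
    and V: "L2_embedding \<Omega> \<iota>" "dual_Linf_embedding \<Omega> \<iota> j"
    and S'adj: "\<forall>w\<in>L2 \<Omega>. L2_is_adjoint \<Omega> (S' w) (\<lambda>y. j (S'adj w y))"
    and S'adj_cont: "\<forall>ui w y. L2_weakly_tendsto \<Omega> ui w \<longrightarrow>
                       (\<lambda>i. norm (S'adj (ui i) y - S'adj w y)) \<longlonglongrightarrow> 0"
    and u_min: "\<forall>n. is_arg_min (energy \<Omega> g S (zn n)) (\<lambda>w. w \<in> L2 \<Omega>) (u n)"
    and p: "\<forall>n. p n = S'adj (u n) (zn n - S (u n))"
    and u_conv: "L2_weakly_tendsto \<Omega> u ubar"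
    and Su_conv: "(\<lambda>n. S (u n)) \<longlonglongrightarrow> S ubar"
    and p_conv: "p \<longlonglongrightarrow> pbar"
    and ubar_min: "is_arg_min (energy \<Omega> g S z) (\<lambda>w. w \<in> L2 \<Omega>) ubar"
    and pbar: "- pbar = S'adj ubar (S ubar - z)"
    and ubar_subdiff: "ubar \<in> subdiff_on (L2 \<Omega>) (L2_inner \<Omega>)
           (conjugate_on (L2 \<Omega>) (L2_inner \<Omega>) (integral_functional \<Omega> g)) (j pbar)"
  shows "(\<forall>P. compact P \<and> P \<subseteq> Q \<longrightarrow>
           (\<forall>\<^sub>F n in sequentially. AE x in lebesgue_on (Omega_part \<Omega> (j pbar) P).
              u n x = ubar x \<and> ubar x \<in> M)) \<and>
         ((\<lambda>n. L2_norm (Omega_part \<Omega> (j pbar) Q) (\<lambda>x. u n x - ubar x)) \<longlonglongrightarrow> 0 \<and>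
          (AE x in lebesgue_on (Omega_part \<Omega> (j pbar) Q). ubar x \<in> M))"
proof -
  let ?N = "lebesgue_on \<Omega>" and ?W = "dominance (\<lambda>v. \<alpha> * c v) M"
  let ?sub = "\<lambda>q. subdiff (conjugate (penalty \<alpha> c M)) q"
  have \<Omega>_lm: "\<Omega> \<in> lmeasurable"
    using \<Omega> by (simp add: lmeasurable_open)
  then have \<Omega>_sets: "\<Omega> \<in> sets lebesgue"
    by (rule fmeasurableD)
  have u_L2: "u n \<in> L2 \<Omega>" for n
    using u_min by (simp add: is_arg_min_def)
  have ubar_L2: "ubar \<in> L2 \<Omega>"
    using ubar_min by (simp add: is_arg_min_def)
  have j_meas [measurable]: "j w \<in> borel_measurable ?N" for w
    using V(2) by (simp add: dual_Linf_embedding_def)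
  note adj = S'adj[unfolded L2_is_adjoint_def, rule_format]
  note min_sub = minimizer_subgradient[OF \<Omega>_lm M \<alpha> c(1)[rule_format]]

  \<comment> \<open>Both the approximate and the limit minimizer satisfy the pointwise inclusion.\<close>
  have u_sub: "AE x in ?N. u n x \<in> ?sub (j (p n) x)" for n
    using u_min[rule_format, of n] S_diff u_L2 adj[OF u_L2] p
    by (intro min_sub) (auto simp: g)
  \<comment> \<open>\<open>pbar\<close> is characterized through \<open>- pbar\<close>, so its representative has to be rewritten first.\<close>
  have pbar_eq: "L2_eq \<Omega> (j pbar) (\<lambda>x. - j (- pbar) x)"
  proof -
    note scale = V(2)[unfolded dual_Linf_embedding_def, THEN conjunct2, THEN conjunct2,
        THEN conjunct2, THEN conjunct1]
    have "L2_eq \<Omega> (j ((-1) *\<^sub>R (- pbar))) (\<lambda>x. (-1) *\<^sub>R j (- pbar) x)"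
      using scale by blast
    then show ?thesis
      by simp
  qed
  have neg_pbar_L2: "(\<lambda>x. - j (- pbar) x) \<in> L2 \<Omega>"
    using adj[OF ubar_L2, of "S ubar - z"] L2_scaleR[of "j (- pbar)" \<Omega> "-1"] by (simp add: pbar)
  have pbar_L2: "j pbar \<in> L2 \<Omega>"
    by (rule L2_cong[OF pbar_eq neg_pbar_L2]) measurable
  have ubar_sub: "AE x in ?N. ubar x \<in> ?sub (j pbar x)"
  proof (rule min_sub[OF _ _ pbar_L2])
    show "is_arg_min (energy \<Omega> (penalty \<alpha> c M) S z) (\<lambda>w. w \<in> L2 \<Omega>) ubar"
      using ubar_min by (simp add: g)
    show "L2_has_derivative \<Omega> S (S' ubar) ubar"
      using S_diff ubar_L2 by blast
    fix h :: "real^'n \<Rightarrow> real^'m" assume h: "h \<in> L2 \<Omega>"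
    have "S' ubar h \<bullet> (z - S ubar) = - (S' ubar h \<bullet> (S ubar - z))"
      by (simp add: inner_diff_right)
    also have "\<dots> = - L2_inner \<Omega> h (j (- pbar))"
      using adj[OF ubar_L2, of "S ubar - z"] h by (simp add: pbar)
    also have "\<dots> = L2_inner \<Omega> h (j pbar)"
      using L2_inner_cong_right[OF pbar_eq h pbar_L2 neg_pbar_L2] L2_inner_minus_right by metis
    finally show "S' ubar h \<bullet> (z - S ubar) = L2_inner \<Omega> h (j pbar)" .
  qed
  obtain C where C: "\<And>w w'. AE x in ?N. norm (j w x - j w' x) \<le> C * norm (w - w')"
    using dual_Linf_embedding_diff[OF V(2)] by blast
  have p_norm: "(\<lambda>n. C * norm (p n - pbar)) \<longlonglongrightarrow> 0"
    using tendsto_mult_right_zero[OF tendsto_norm_zero[OF LIM_zero[OF p_conv]]] by simp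
  have Q_eq: "Q = (\<Union>v\<in>M. ?W v)"
    unfolding Q g by (rule single_valued_set_eq[OF M])
  have W_open: "open (?W v)" for v
    by (rule open_dominance[OF M(1)])
  have Q_borel: "Q \<in> sets borel"
    unfolding Q_eq using W_open by (intro borel_open) blast

  have compact_part: "\<forall>\<^sub>F n in sequentially. AE x in lebesgue_on (Omega_part \<Omega> (j pbar) P).
      u n x = ubar x \<and> ubar x \<in> M" if P: "compact P" "P \<subseteq> Q" for P
  proof -
    \<comment> \<open>A Lebesgue number of the cover of \<open>P\<close> by the regions of constant subgradient.\<close>
    obtain \<epsilon> where \<epsilon>: "0 < \<epsilon>" "\<And>q. q \<in> P \<Longrightarrow> \<exists>G\<in>?W ` M. ball q \<epsilon> \<subseteq> G"
      using Heine_Borel_lemma[OF P(1), of "?W ` M"] P(2) W_open unfolding Q_eq by blast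
    from \<epsilon>(1) have "\<forall>\<^sub>F n in sequentially. C * norm (p n - pbar) < \<epsilon>"
      using order_tendstoD(2)[OF p_norm] by blast
    then show ?thesis
    proof eventually_elim
      case (elim n)
      have "AE x in ?N. j pbar x \<in> P \<longrightarrow> u n x = ubar x \<and> ubar x \<in> M"
        using u_sub[of n] ubar_sub C[of "p n" pbar]
      proof eventually_elim
        case (elim x)
        show ?case
        proof
          assume "j pbar x \<in> P"
          then obtain v where v: "v \<in> M" "ball (j pbar x) \<epsilon> \<subseteq> ?W v"
            using \<epsilon>(2) by blast
          have "j (p n) x \<in> ?W v" "j pbar x \<in> ?W v"
            using v(2) \<epsilon>(1) elim(3) \<open>C * norm (p n - pbar) < \<epsilon>\<close>
            by (auto simp: dist_norm norm_minus_commute)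
          then have "u n x = v" "ubar x = v"
            using subgradient_dominance[OF M(1) v(1)] elim(1,2) by blast+
          then show "u n x = ubar x \<and> ubar x \<in> M"
            using v(1) by simp
        qed
      qed
      then show ?case
        by (rule AE_Omega_part_iff[OF \<Omega>_sets j_meas borel_compact[OF P(1)], THEN iffD2])
    qed
  qed

  let ?\<Omega>Q = "Omega_part \<Omega> (j pbar) Q"
  note AE_Q = AE_Omega_part_iff[OF \<Omega>_sets j_meas Q_borel]
  have "AE x in ?N. j pbar x \<in> Q \<longrightarrow> ubar x \<in> M"
    using ubar_sub
  proof eventually_elim
    case (elim x)
    then show ?case
      using subgradient_dominance[OF M(1)] unfolding Q_eq by blast
  qed
  then have ubar_M: "AE x in lebesgue_on ?\<Omega>Q. ubar x \<in> M"
    by (simp add: AE_Q)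

  \<comment> \<open>At almost every point over \<open>Q\<close> the sequence is eventually constant, but from an index
    that depends on the point; dominated convergence takes the place of uniformity.\<close>
  have "AE x in ?N. (\<forall>n. u n x \<in> ?sub (j (p n) x)) \<and>
      (\<forall>n. norm (j (p n) x - j pbar x) \<le> C * norm (p n - pbar))"
    using u_sub C by (simp add: AE_all_countable)
  then have "AE x in ?N. j pbar x \<in> Q \<longrightarrow> (\<lambda>n. u n x) \<longlonglongrightarrow> ubar x"
    using ubar_sub
  proof eventually_elim
    case (elim x)
    note x = elim
    show ?case
    proof
      assume "j pbar x \<in> Q"
      then obtain v where v: "v \<in> M" "j pbar x \<in> ?W v"
        unfolding Q_eq by blast
      have "\<forall>\<^sub>F n in sequentially. norm (j (p n) x - j pbar x) \<le> C * norm (p n - pbar)"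
        by (rule always_eventually[OF conjunct2[OF x(1)]])
      from LIM_zero_cancel[OF Lim_null_comparison[OF this p_norm]]
      have "(\<lambda>n. j (p n) x) \<longlonglongrightarrow> j pbar x" .
      then have "\<forall>\<^sub>F n in sequentially. j (p n) x \<in> ?W v"
        using W_open v(2) by (rule topological_tendstoD)
      then have "\<forall>\<^sub>F n in sequentially. u n x = ubar x"
      proof eventually_elim
        case (elim n)
        have "u n x = v" "ubar x = v"
          using subgradient_dominance[OF M(1) v(1) elim x(1)[THEN conjunct1, rule_format]]
            subgradient_dominance[OF M(1) v x(2)] by simp_all
        then show ?case
          by simp
      qed
      then show "(\<lambda>n. u n x) \<longlonglongrightarrow> ubar x"
        by (rule tendsto_eventually)
    qed
  qed
  then have conv: "AE x in lebesgue_on ?\<Omega>Q. (\<lambda>n. u n x) \<longlonglongrightarrow> ubar x"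
    by (simp add: AE_Q)

  define R where "R = Max (norm ` M)"
  have R: "norm v \<le> R" if "v \<in> M" for v
    unfolding R_def using M(1) that by simp
  have bound: "AE x in lebesgue_on ?\<Omega>Q. norm ((u n x - ubar x) \<bullet> (u n x - ubar x)) \<le> (2 * R)\<^sup>2" for n
    unfolding AE_Q using u_sub[of n] ubar_sub
  proof eventually_elim
    case (elim x)
    have "norm (u n x) \<le> R" "norm (ubar x) \<le> R"
      using elim subgradient_norm_le[OF M R] by blast+
    then have "norm (u n x - ubar x) \<le> 2 * R"
      using norm_triangle_ineq4[of "u n x" "ubar x"] by linarith
    then have "(norm (u n x - ubar x))\<^sup>2 \<le> (2 * R)\<^sup>2"
      by (rule power_mono) simp
    then show ?case
      by (simp add: power2_norm_eq_inner)
  qed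
  have meas: "(\<lambda>x. (u n x - ubar x) \<bullet> (u n x - ubar x)) \<in> borel_measurable (lebesgue_on ?\<Omega>Q)" for n
  proof (rule measurable_restrict_mono)
    show "(\<lambda>x. (u n x - ubar x) \<bullet> (u n x - ubar x)) \<in> borel_measurable ?N"
      using L2D(1)[OF u_L2[of n]] L2D(1)[OF ubar_L2] by measurable
  qed (auto simp: Omega_part_def)
  have "?\<Omega>Q \<in> lmeasurable"
    using Omega_part_sets[OF j_meas Q_borel] \<Omega>_lm \<Omega>_sets
    by (auto simp: sets_restrict_space_iff Omega_part_def intro: bounded_set_imp_lmeasurable[OF bounded_subset[OF \<Omega>(2)]])
  then interpret finite_measure "lebesgue_on ?\<Omega>Q"
    by (rule finite_measure_lebesgue_on)
  have "(\<lambda>n. LINT x|lebesgue_on ?\<Omega>Q. (u n x - ubar x) \<bullet> (u n x - ubar x))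
      \<longlonglongrightarrow> (LINT x|lebesgue_on ?\<Omega>Q. 0)"
  proof (rule integral_dominated_convergence[where w = "\<lambda>_. (2 * R)\<^sup>2"])
    show "AE x in lebesgue_on ?\<Omega>Q. (\<lambda>n. (u n x - ubar x) \<bullet> (u n x - ubar x)) \<longlonglongrightarrow> 0"
      using conv
    proof eventually_elim
      case (elim x)
      from tendsto_inner[OF LIM_zero[OF elim] LIM_zero[OF elim]] show ?case
        by simp
    qed
  qed (use bound meas in simp_all)
  then have "(\<lambda>n. L2_norm ?\<Omega>Q (\<lambda>x. u n x - ubar x)) \<longlonglongrightarrow> 0"
    unfolding L2_norm_def L2_inner_def using tendsto_real_sqrt by fastforce
  then show ?thesis
    using compact_part ubar_M by blast
qed

end
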